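(* Let $G$ be a graph on $n$ vertices. If $\vartheta(\overline{G})=d_\infty(G,R_G)$, then $$\frac{\chi(G)}{\|P_G\|}\le\vartheta(\overline{G})\le\chi(G).$$
   Context: $M_n$ denotes the complex $n\times n$ matrices with the operator norm $\|\cdot\|$ and matrix units $E_{i,j}$. A graph $G$ on $n$ vertices is a symmetric subset $G\subseteq\{1,\dots,n\}^2$ containing no $(i,i)$; $\widetilde G=G\cup\{(i,i):1\le i\le n\}$; the complement $\overline{G}$ is the graph with $(i,j)\in\overline G\iff(i,j)\notin\widetilde G$. $\mathcal{S}_G=\operatorname{span}\{E_{i,j}:(i,j)\in\widetilde G\}$, $\mathcal{S}_G^\perp=\operatorname{span}\{E_{i,j}:(i,j)\in\overline G\}$ (the orthogonal complement of $\mathcal S_G$ for $\operatorname{tr}(ab^* )$). $R_G=\sum_{(i,j)\in\widetilde G}E_{i,j}=I+A_G$, where $A_G$ is the adjacency matrix. $d_\infty(G,X)=\inf\{\|X+K\|:K\in\mathcal{S}_G^\perp\}$ for $X\in M_n$. The Lovász theta function is $\vartheta(G)=\sup\{\|I+K\|:K\in\mathcal{S}_G^\perp,\ I+K\ge 0\}$; equivalently $\vartheta(\overline G)=\min\{\lambda_1(R_G+K):K=K^*\in\mathcal{S}_G^\perp\}$, where $\lambda_1$ denotes the largest eigenvalue. $\chi(G)$ is the chromatic number of $G$. $P_G:M_n\to\mathcal{S}_G$ is the orthogonal projection, i.e. Schur (entrywise) multiplication by $R_G$, and $\|P_G\|$ is its norm as a linear map when $M_n$ and $\mathcal{S}_G$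 carry the operator norm (the Schur multiplier norm of $R_G$). *)

theory Defs
  imports "HOL-Analysis.Analysis"
begin

text \<open>
  Vertices are the elements of a finite type \<open>'n\<close>, so \<open>n = CARD('n)\<close>; a graph on them is a
  relation \<open>G\<close> with \<open>sym G\<close> and \<open>irrefl G\<close>, and \<open>M\<^sub>n\<close> is \<open>complex^'n^'n\<close>.
\<close>

type_synonym 'n cmat = "complex^'n^'n"

definition refl_graph :: "('n \<times> 'n) set \<Rightarrow> ('n \<times> 'n) set" where
  "refl_graph G = G \<union> Id"

definition graph_compl :: "('n \<times> 'n) set \<Rightarrow> ('n \<times> 'n) set" where
  "graph_compl G = - refl_graph G"

definition chromatic_number :: "('n::finite \<times> 'n) set \<Rightarrow> nat" where
  "chromatic_number G =
     (LEAST k. \<exists>c :: 'n \<Rightarrow> nat. (\<forall>v. c v < k) \<and> (\<forall>(u, v) \<in> G. c u \<noteq> c v))"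

text \<open>
  The \<open>norm\<close> that the type \<open>complex^'n^'n\<close> carries is the Frobenius norm; the operator norm
  is the one induced by the Euclidean norm of \<open>complex^'n\<close>.
\<close>

definition opnorm :: "'n::finite cmat \<Rightarrow> real" where
  "opnorm A = onorm (\<lambda>x. A *v x)"

definition pos_semidef :: "'n::finite cmat \<Rightarrow> bool" where
  "pos_semidef A \<longleftrightarrow>
     (\<forall>x. (\<Sum>i\<in>UNIV. cnj (x $ i) * (A *v x) $ i) \<in> \<real> \<and>
          0 \<le> Re (\<Sum>i\<in>UNIV. cnj (x $ i) * (A *v x) $ i))"

definition cmat_adjoint :: "'n::finite cmat \<Rightarrow> 'n cmat" where
  "cmat_adjoint A = (\<chi> i j. cnj (A $ j $ i))"

definition cmat_scale :: "complex \<Rightarrow> 'n::finite cmat \<Rightarrow> 'n cmat" where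
  "cmat_scale c A = (\<chi> i j. c * A $ i $ j)"

text \<open>
  The library equips \<open>complex^'n^'n\<close> only with a real span; \<open>cmat.span\<close> is the complex one.
\<close>

global_interpretation cmat: vector_space "cmat_scale :: complex \<Rightarrow> 'n::finite cmat \<Rightarrow> 'n cmat"
  by unfold_locales (simp_all add: cmat_scale_def vec_eq_iff algebra_simps)

definition matrix_unit :: "'n::finite \<Rightarrow> 'n \<Rightarrow> 'n cmat" where
  "matrix_unit i j = (\<chi> k l. if k = i \<and> l = j then 1 else 0)"

definition S_space :: "('n::finite \<times> 'n) set \<Rightarrow> 'n cmat set" where
  "S_space G = cmat.span ((\<lambda>(i, j). matrix_unit i j) ` refl_graph G)"

definition S_perp :: "('n::finite \<times> 'n) set \<Rightarrow> 'n cmat set" where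
  "S_perp G = cmat.span ((\<lambda>(i, j). matrix_unit i j) ` graph_compl G)"

definition R_mat :: "('n::finite \<times> 'n) set \<Rightarrow> 'n cmat" where
  "R_mat G = (\<Sum>(i, j) \<in> refl_graph G. matrix_unit i j)"

definition d_inf :: "('n::finite \<times> 'n) set \<Rightarrow> 'n cmat \<Rightarrow> real" where
  "d_inf G X = Inf {opnorm (X + K) | K. K \<in> S_perp G}"

definition lovasz_theta :: "('n::finite \<times> 'n) set \<Rightarrow> real" where
  "lovasz_theta G = Sup {opnorm (mat 1 + K) | K. K \<in> S_perp G \<and> pos_semidef (mat 1 + K)}"

definition P_proj :: "('n::finite \<times> 'n) set \<Rightarrow> 'n cmat \<Rightarrow> 'n cmat" where
  "P_proj G X = (\<chi> i j. R_mat G $ i $ j * X $ i $ j)"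

text \<open>
  Both sides carry the operator norm, so this is not \<open>onorm (P_proj G)\<close>, which would
  refer to the Frobenius norm.
\<close>

definition P_norm :: "('n::finite \<times> 'n) set \<Rightarrow> real" where
  "P_norm G = Sup {opnorm (P_proj G X) | X. opnorm X \<le> 1}"

lemma span_matrix_units:
  "cmat.span ((\<lambda>(i, j). matrix_unit i j) ` H) = {A. \<forall>i j. (i, j) \<notin> H \<longrightarrow> A $ i $ j = 0}"
  (is "?S = ?T")
proof
  have "cmat.subspace ?T"
    by (auto simp: cmat.subspace_def cmat_scale_def)
  moreover have "(\<lambda>(i, j). matrix_unit i j) ` H \<subseteq> ?T"
    by (auto simp: matrix_unit_def)
  ultimately show "?S \<subseteq> ?T"
    by (rule cmat.span_minimal[rotated])
next
  show "?T \<subseteq> ?S"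
  proof
    fix A assume A: "A \<in> ?T"
    have "A = (\<Sum>p\<in>H. cmat_scale (A $ fst p $ snd p) (matrix_unit (fst p) (snd p)))"
      (is "_ = ?B")
    proof -
      have "?B $ k $ l = A $ k $ l" for k l
      proof -
        have "?B $ k $ l = (\<Sum>p\<in>H. if p = (k, l) then A $ k $ l else 0)"
          by (auto simp: cmat_scale_def matrix_unit_def prod_eq_iff intro!: sum.cong)
        also have "\<dots> = A $ k $ l"
          using A by simp
        finally show ?thesis .
      qed
      then show ?thesis
        by (simp add: vec_eq_iff)
    qed
    also have "\<dots> \<in> ?S"
      by (intro cmat.span_sum cmat.span_scale cmat.span_base) force
    finally show "A \<in> ?S" .
  qed
qed

lemma R_mat_nth: "R_mat G $ i $ j = (if (i, j) \<in> refl_graph G then 1 else 0)"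
proof -
  have "R_mat G $ i $ j = (\<Sum>p\<in>refl_graph G. if p = (i, j) then 1 else 0)"
    unfolding R_mat_def by (auto simp: matrix_unit_def case_prod_unfold prod_eq_iff intro!: sum.cong)
  then show ?thesis by simp
qed

text \<open>
  The Schur multiplier \<open>P_proj G\<close> is the orthogonal projection onto \<open>S_space G\<close>, and
  \<open>S_perp G\<close> the orthogonal complement of \<open>S_space G\<close>, for \<open>tr (a b\<^sup>*)\<close>.
\<close>

lemma trace_adjoint:
  "trace (A ** cmat_adjoint B) = (\<Sum>i\<in>UNIV. \<Sum>j\<in>UNIV. A $ i $ j * cnj (B $ i $ j))"
  by (simp add: trace_def matrix_matrix_mult_def cmat_adjoint_def)

lemma S_perp_orthogonal:
  "S_perp G = {K. \<forall>Z \<in> S_space G. trace (K ** cmat_adjoint Z) = 0}"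
proof (intro equalityI subsetI CollectI ballI)
  fix K Z :: "'a cmat" assume "K \<in> S_perp G" "Z \<in> S_space G"
  then have "K $ i $ j * cnj (Z $ i $ j) = 0" for i j
    by (auto simp: S_perp_def S_space_def span_matrix_units graph_compl_def)
  then show "trace (K ** cmat_adjoint Z) = 0"
    unfolding trace_adjoint by (intro sum.neutral ballI)
next
  fix K :: "'a cmat" assume K: "K \<in> {K. \<forall>Z \<in> S_space G. trace (K ** cmat_adjoint Z) = 0}"
  have "K $ i $ j = 0" if "(i, j) \<in> refl_graph G" for i j
  proof -
    have "matrix_unit i j \<in> S_space G"
      unfolding S_space_def using that by (intro cmat.span_base) force
    then have "0 = trace (K ** cmat_adjoint (matrix_unit i j))"
      using K by simp
    also have "\<dots> = (\<Sum>k\<in>UNIV. \<Sum>l\<in>UNIV. if k = i then if l = j then K $ i $ j else 0 else 0)"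
      unfolding trace_adjoint by (intro sum.cong) (auto simp: matrix_unit_def)
    also have "\<dots> = (\<Sum>k\<in>UNIV. if k = i then K $ i $ j else 0)"
      by (intro sum.cong) auto
    also have "\<dots> = K $ i $ j"
      by simp
    finally show ?thesis by simp
  qed
  then show "K \<in> S_perp G"
    by (auto simp: S_perp_def span_matrix_units graph_compl_def)
qed

lemma P_proj_orthogonal:
  "P_proj G X \<in> S_space G" "X - P_proj G X \<in> S_perp G"
  by (auto simp: S_space_def S_perp_def span_matrix_units P_proj_def R_mat_nth graph_compl_def)

end

theory Submission
  imports Defs
begin

text \<open>
  The chromatic number bounds \<open>\<vartheta>\<close> from above, and divided by the norm of the projection it
  bounds the distance \<open>d\<^sub>\<infinity>\<close> from below; the hypothesis identifies \<open>\<vartheta>\<close> with that distance.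

  Upper bound. The matrices over which \<open>\<vartheta>\<close> of the complement is a supremum are the positive
  semidefinite \<open>A\<close> with unit diagonal whose other entries are supported on \<open>G\<close>. Such an \<open>A\<close>
  restricts to the identity on every colour class of a proper colouring. Splitting a vector into
  its \<open>k\<close> colour components \<open>x\<^sub>c\<close>, which are pairwise orthogonal, a positive semidefinite quadratic
  form \<open>q\<close> satisfies \<open>q (\<Sum>x\<^sub>c) \<le> k * (\<Sum>q x\<^sub>c)\<close>, and here the right-hand side is \<open>k\<close> times
  the squared norm. So \<open>A\<close> has norm at most \<open>k\<close> (\<open>opnorm_le_colours\<close>).

  Lower bound. The projection \<open>P\<close> maps every competitor \<open>R + K\<close> in the distance \<open>d\<^sub>\<infinity>\<close> to \<open>R\<close>
  itself, so the norm of \<open>R\<close> is at most the norm of \<open>P\<close> times the distance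
  (\<open>opnorm_R_mat_le_d_inf\<close>). What remains is Wilf's theorem that \<open>\<chi>\<close> is at most the norm of
  \<open>R\<close> (\<open>wilf\<close>): testing \<open>R\<close> on the indicator vector of a vertex set \<open>W\<close> bounds one plus the
  average degree of the graph induced on \<open>W\<close>, so every induced subgraph has a vertex of small
  degree, and colouring greedily along such vertices succeeds.
\<close>


section \<open>The operator norm\<close>

lemma norm_matrix_vector_le_opnorm:
  fixes A :: "'n::finite cmat"
  shows "norm (A *v x) \<le> opnorm A * norm x"
  unfolding opnorm_def by (rule onorm[OF matrix_vector_mul_bounded_linear])

lemma opnorm_nonneg: "0 \<le> opnorm (A :: 'n::finite cmat)"
  unfolding opnorm_def by (rule onorm_pos_le[OF matrix_vector_mul_bounded_linear])

lemma norm_entry_le_opnorm: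
  fixes A :: "'n::finite cmat"
  shows "norm (A $ i $ j) \<le> opnorm A"
proof -
  have "A $ i $ j = (A *v axis j 1) $ i"
    by (simp add: matrix_vector_mult_def axis_def if_distrib cong: if_cong)
  then have "norm (A $ i $ j) \<le> norm (A *v axis j 1)"
    by (simp add: Finite_Cartesian_Product.norm_nth_le)
  also have "\<dots> \<le> opnorm A * norm (axis j 1 :: complex^'n)"
    by (rule norm_matrix_vector_le_opnorm)
  finally show ?thesis by simp
qed

lemma opnorm_le_sum_entries:
  fixes A :: "'n::finite cmat"
  shows "opnorm A \<le> (\<Sum>i\<in>UNIV. \<Sum>j\<in>UNIV. norm (A $ i $ j))"
  unfolding opnorm_def
proof (rule onorm_bound)
  fix x :: "complex^'n"
  have "norm (A *v x) \<le> (\<Sum>i\<in>UNIV. norm ((A *v x) $ i))"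
    unfolding norm_vec_def by (intro L2_set_le_sum) auto
  also have "\<dots> \<le> (\<Sum>i\<in>UNIV. \<Sum>j\<in>UNIV. norm (A $ i $ j) * norm x)"
    by (auto simp: matrix_vector_mult_def norm_mult
        intro!: sum_mono order_trans[OF norm_sum] mult_left_mono Finite_Cartesian_Product.norm_nth_le)
  finally show "norm (A *v x) \<le> (\<Sum>i\<in>UNIV. \<Sum>j\<in>UNIV. norm (A $ i $ j)) * norm x"
    by (simp add: sum_distrib_right)
qed (intro sum_nonneg norm_ge_zero)

lemma opnorm_mat_1: "opnorm (mat 1 :: 'n::finite cmat) = 1"
proof -
  have "1 \<le> opnorm (mat 1 :: 'n cmat)"
    using norm_entry_le_opnorm[of "mat 1 :: 'n cmat" undefined undefined] by (simp add: mat_def)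
  moreover have "opnorm (mat 1 :: 'n cmat) \<le> 1"
    unfolding opnorm_def by (rule onorm_bound) auto
  ultimately show ?thesis by simp
qed

lemma opnorm_cmat_scale:
  fixes X :: "'n::finite cmat"
  shows "opnorm (cmat_scale c X) = norm c * opnorm X"
proof -
  have le: "opnorm (cmat_scale c X) \<le> norm c * opnorm X" for c and X :: "'n cmat"
    unfolding opnorm_def[of "cmat_scale c X"]
  proof (rule onorm_bound)
    fix x
    have "cmat_scale c X *v x = c *s (X *v x)"
      by (simp add: cmat_scale_def matrix_vector_mult_def vec_eq_iff sum_distrib_left mult.assoc)
    moreover have "norm (c *s y) = norm c * norm y" for y :: "complex^'n"
      by (simp add: norm_vec_def norm_mult L2_set_right_distrib)
    ultimately show "norm (cmat_scale c X *v x) \<le> norm c * opnorm X * norm x"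
      using norm_matrix_vector_le_opnorm[of X x] by (simp add: mult.assoc mult_left_mono)
  qed (simp add: opnorm_nonneg)
  show ?thesis
  proof (cases "c = 0")
    case True
    then show ?thesis using le[of c X] opnorm_nonneg[of "cmat_scale c X"] by simp
  next
    case False
    have "X = cmat_scale (inverse c) (cmat_scale c X)"
      using False by (simp add: cmat_scale_def vec_eq_iff)
    then have "opnorm X \<le> norm (inverse c) * opnorm (cmat_scale c X)"
      using le by metis
    then have "norm c * opnorm X \<le> opnorm (cmat_scale c X)"
      using False by (simp add: norm_divide field_simps)
    with le[of c X] show ?thesis by simp
  qed
qed


section \<open>Positive semidefinite matrices\<close>

text \<open>
  The real inner product of \<open>complex^'n\<close> is the real part of the complex one, so real bilinear
  algebra suffices below.
\<close>

lemma inner_eq_Re_sum: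
  fixes x y :: "complex^'n::finite"
  shows "inner x y = Re (\<Sum>i\<in>UNIV. cnj (x $ i) * y $ i)"
  by (simp add: inner_vec_def inner_complex_def)

lemma pos_semidef_inner_nonneg:
  "pos_semidef A \<Longrightarrow> 0 \<le> inner x (A *v x)"
  by (simp add: pos_semidef_def inner_eq_Re_sum)

text \<open>
  A form that is real on the diagonal is Hermitian: expand it at \<open>x + \<i> y\<close>.
\<close>

lemma pos_semidef_inner_commute:
  fixes A :: "'n::finite cmat"
  assumes "pos_semidef A"
  shows "inner x (A *v y) = inner y (A *v x)"
proof -
  define h where "h x y = (\<Sum>i\<in>UNIV. cnj (x $ i) * (A *v y) $ i)" for x y :: "complex^'n"
  have real: "Im (h x x) = 0" for x
    using assms by (auto simp: pos_semidef_def h_def complex_is_Real_iff)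
  have "A *v (x + \<i> *s y) = A *v x + \<i> *s (A *v y)"
    by (simp add: matrix_vector_mult_def vec_eq_iff algebra_simps sum.distrib sum_distrib_left)
  then have "h (x + \<i> *s y) (x + \<i> *s y) = h x x + \<i> * h x y - \<i> * h y x + h y y"
    by (simp add: h_def algebra_simps sum.distrib sum_subtractf sum_distrib_left)
  then have "Im (\<i> * h x y - \<i> * h y x) = 0"
    using real[of "x + \<i> *s y"] real[of x] real[of y] by simp
  then show ?thesis
    by (simp add: inner_eq_Re_sum h_def)
qed

text \<open>
  For a Hermitian matrix the numerical radius equals the norm. Polarisation bounds
  \<open>inner u (A *v x)\<close> for \<open>u\<close> a multiple of \<open>A *v x\<close>; the multiple is chosen to give \<open>u\<close>
  the same length as \<open>x\<close>, which makes the bound sharp.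
\<close>

lemma opnorm_le_of_pos_semidef:
  fixes A :: "'n::finite cmat"
  assumes A: "pos_semidef A" and le: "\<And>x. inner x (A *v x) \<le> k * (norm x)\<^sup>2" and k: "0 \<le> k"
  shows "opnorm A \<le> k"
  unfolding opnorm_def
proof (rule onorm_bound[OF k])
  fix x
  interpret L: bounded_linear "\<lambda>x. A *v x" by (rule matrix_vector_mul_bounded_linear)
  show "norm (A *v x) \<le> k * norm x"
  proof (cases "A *v x = 0")
    case False
    define a where "a = norm (A *v x)"
    define u where "u = (norm x / a) *\<^sub>R (A *v x)"
    have a: "a > 0" using False by (simp add: a_def)
    have x: "norm x > 0" using False by auto
    have "4 * inner u (A *v x) = inner (u + x) (A *v (u + x)) - inner (u - x) (A *v (u - x))"
      using pos_semidef_inner_commute[OF A, of u x]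
      by (simp add: L.add L.diff inner_add inner_diff)
    also have "\<dots> \<le> k * (norm (u + x))\<^sup>2"
      using le[of "u + x"] pos_semidef_inner_nonneg[OF A, of "u - x"] by simp
    also have "\<dots> \<le> k * (2 * norm x)\<^sup>2"
    proof -
      have "norm u = norm x" using a by (simp add: u_def a_def)
      then show ?thesis
        using norm_triangle_ineq[of u x] k by (intro mult_left_mono power_mono) auto
    qed
    also have "inner u (A *v x) = norm x * a"
      using a by (simp add: u_def a_def dot_square_norm power2_eq_square)
    finally have "norm x * a \<le> norm x * (k * norm x)"
      by (simp add: power2_eq_square algebra_simps)
    then show ?thesis using x by (simp add: a_def)
  qed (simp add: k)
qed


section \<open>Colourings bound theta from above\<close>

text \<open>
  Convexity of a nonnegative quadratic form, obtained by summing \<open>q (x\<^sub>c - x\<^sub>d) \<ge> 0\<close> over all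
  pairs of indices.
\<close>

lemma inner_sum_le_card_mult_sum:
  fixes f :: "'a::real_inner \<Rightarrow> 'a"
  assumes f: "linear f" and nonneg: "\<And>x. 0 \<le> inner x (f x)"
  shows "inner (\<Sum>c\<in>I. y c) (f (\<Sum>c\<in>I. y c)) \<le> card I * (\<Sum>c\<in>I. inner (y c) (f (y c)))"
proof -
  interpret linear f by (rule f)
  have "0 \<le> (\<Sum>c\<in>I. \<Sum>d\<in>I. inner (y c - y d) (f (y c - y d)))"
    by (intro sum_nonneg nonneg)
  also have "\<dots> = (\<Sum>c\<in>I. \<Sum>d\<in>I. inner (y c) (f (y c))) + (\<Sum>c\<in>I. \<Sum>d\<in>I. inner (y d) (f (y d)))
      - (\<Sum>c\<in>I. \<Sum>d\<in>I. inner (y c) (f (y d))) - (\<Sum>c\<in>I. \<Sum>d\<in>I. inner (y d) (f (y c)))"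
    by (simp add: diff inner_diff sum.distrib sum_subtractf algebra_simps)
  also have "(\<Sum>c\<in>I. \<Sum>d\<in>I. inner (y d) (f (y c))) = (\<Sum>c\<in>I. \<Sum>d\<in>I. inner (y c) (f (y d)))"
    by (rule sum.swap)
  also have "(\<Sum>c\<in>I. \<Sum>d\<in>I. inner (y c) (f (y d))) = inner (\<Sum>c\<in>I. y c) (f (\<Sum>c\<in>I. y c))"
    unfolding sum inner_sum_left inner_sum_right by (rule sum.swap)
  finally show ?thesis by (simp flip: sum_distrib_left)
qed

text \<open>
  The colour components of \<open>x\<close> are orthogonal, and the hypothesis on \<open>A\<close> says that its
  compression to each colour class is the identity.
\<close>

lemma opnorm_le_colours:
  fixes A :: "'n::finite cmat" and c :: "'n \<Rightarrow> nat"
  assumes A: "pos_semidef A"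
    and c: "\<And>v. c v < k"
    and id: "\<And>i j. c i = c j \<Longrightarrow> A $ i $ j = (if i = j then 1 else 0)"
  shows "opnorm A \<le> k"
proof (rule opnorm_le_of_pos_semidef[OF A])
  fix x :: "complex^'n"
  define y where "y t = (\<chi> i. if c i = t then x $ i else 0)" for t
  have x: "x = (\<Sum>t<k. y t)"
    using c by (simp add: vec_eq_iff y_def)
  have orth: "inner (y s) (y t) = 0" if "s \<noteq> t" for s t
    using that by (auto simp: inner_vec_def y_def intro!: sum.neutral)
  have "inner (y t) (A *v y t) = (norm (y t))\<^sup>2" for t
  proof -
    have "(A *v y t) $ i = y t $ i" if "c i = t" for i
    proof -
      have "A $ i $ j * y t $ j = (if j = i then x $ i else 0)" for j
        using that id[of i j] by (auto simp: y_def)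
      then have "(A *v y t) $ i = (\<Sum>j\<in>UNIV. if j = i then x $ i else 0)"
        by (simp add: matrix_vector_mult_def)
      then show ?thesis using that by (simp add: y_def)
    qed
    then have "inner (y t) (A *v y t) = inner (y t) (y t)"
      unfolding inner_vec_def by (intro sum.cong) (auto simp: y_def)
    then show ?thesis by (simp add: dot_square_norm)
  qed
  moreover have "linear (\<lambda>x. A *v x)"
    by (rule bounded_linear.linear[OF matrix_vector_mul_bounded_linear])
  ultimately have "inner x (A *v x) \<le> k * (\<Sum>t<k. (norm (y t))\<^sup>2)"
    using inner_sum_le_card_mult_sum[of "\<lambda>x. A *v x" y "{..<k}"] pos_semidef_inner_nonneg[OF A]
    unfolding x by simp
  also have "(\<Sum>t<k. (norm (y t))\<^sup>2) = (norm x)\<^sup>2"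
    unfolding x using orth
    by (intro norm_sum_Pythagorean[symmetric]) (auto simp: pairwise_def orthogonal_def)
  finally show "inner x (A *v x) \<le> k * (norm x)\<^sup>2" .
qed simp

lemma chromatic_number_colouring:
  fixes G :: "('n::finite \<times> 'n) set"
  assumes "irrefl G"
  obtains c :: "'n \<Rightarrow> nat"
  where "\<And>v. c v < chromatic_number G" "\<And>u v. (u, v) \<in> G \<Longrightarrow> c u \<noteq> c v"
proof -
  obtain f :: "'n \<Rightarrow> nat" where f: "f ` UNIV = {..<CARD('n)}" "inj f"
    using ex_bij_betw_finite_nat[of "UNIV :: 'n set"] by (auto simp: bij_betw_def atLeast0LessThan)
  have "\<forall>v. f v < CARD('n)" using f(1) by auto
  moreover have "\<forall>(u, v) \<in> G. f u \<noteq> f v" using f(2) assms by (auto simp: irrefl_def inj_def)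
  ultimately have "\<exists>k. \<exists>c :: 'n \<Rightarrow> nat. (\<forall>v. c v < k) \<and> (\<forall>(u, v) \<in> G. c u \<noteq> c v)"
    by blast
  then have "\<exists>c :: 'n \<Rightarrow> nat. (\<forall>v. c v < chromatic_number G) \<and> (\<forall>(u, v) \<in> G. c u \<noteq> c v)"
    unfolding chromatic_number_def by (rule LeastI_ex)
  then show thesis using that by blast
qed

lemma lovasz_theta_compl_le_chromatic_number:
  fixes G :: "('n::finite \<times> 'n) set"
  assumes "irrefl G"
  shows "lovasz_theta (graph_compl G) \<le> chromatic_number G"
  unfolding lovasz_theta_def
proof (rule cSup_least)
  have "pos_semidef (mat 1 + 0 :: 'n cmat)"
    unfolding pos_semidef_def
  proof
    fix x :: "complex^'n"
    have "(\<Sum>i\<in>UNIV. cnj (x $ i) * ((mat 1 + 0) *v x) $ i)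
        = of_real (\<Sum>i\<in>UNIV. (norm (x $ i))\<^sup>2)"
      unfolding of_real_sum complex_norm_square by (simp add: mult.commute)
    then show "(\<Sum>i\<in>UNIV. cnj (x $ i) * ((mat 1 + 0) *v x) $ i) \<in> \<real> \<and>
        0 \<le> Re (\<Sum>i\<in>UNIV. cnj (x $ i) * ((mat 1 + 0) *v x) $ i)"
      by (simp add: sum_nonneg)
  qed
  moreover have "0 \<in> S_perp (graph_compl G)"
    unfolding S_perp_def by (rule cmat.span_zero)
  ultimately show "{opnorm (mat 1 + K) |K. K \<in> S_perp (graph_compl G) \<and> pos_semidef (mat 1 + K)} \<noteq> {}"
    by blast
next
  fix r assume "r \<in> {opnorm (mat 1 + K) |K. K \<in> S_perp (graph_compl G) \<and> pos_semidef (mat 1 + K)}"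
  then obtain K where K: "K \<in> S_perp (graph_compl G)" "pos_semidef (mat 1 + K)"
    and r: "r = opnorm (mat 1 + K)" by blast
  obtain c where c: "\<And>v. c v < chromatic_number G" "\<And>u v. (u, v) \<in> G \<Longrightarrow> c u \<noteq> c v"
    using chromatic_number_colouring[OF assms] by blast
  have "K $ i $ j = 0" if "c i = c j" for i j
  proof -
    have "(i, j) \<notin> graph_compl (graph_compl G)"
      using c(2)[of i j] that by (auto simp: graph_compl_def refl_graph_def)
    then show ?thesis
      using K(1) by (simp add: S_perp_def span_matrix_units)
  qed
  then show "r \<le> chromatic_number G"
    unfolding r using K(2) c(1) by (intro opnorm_le_colours) (auto simp: mat_def)
qed


section \<open>Wilf's bound on the chromatic number\<close>

text \<open>
  Remove a vertex of small degree, colour the rest, and give the removed vertex a colour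
  that its fewer than \<open>m\<close> neighbours leave free.
\<close>

lemma greedy_colouring:
  assumes "finite W" "sym G" "irrefl G"
    and "\<And>S. S \<subseteq> W \<Longrightarrow> S \<noteq> {} \<Longrightarrow> \<exists>v\<in>S. card {u \<in> S. (v, u) \<in> G} < m"
  shows "\<exists>c :: 'a \<Rightarrow> nat. (\<forall>v\<in>W. c v < m) \<and> (\<forall>u\<in>W. \<forall>v\<in>W. (u, v) \<in> G \<longrightarrow> c u \<noteq> c v)"
  using assms(1,4)
proof (induction W rule: finite_psubset_induct)
  case (psubset W)
  show ?case
  proof (cases "W = {}")
    case False
    then obtain v where v: "v \<in> W" "card {u \<in> W. (v, u) \<in> G} < m"
      using psubset.prems[of W] by blast
    have "\<exists>c :: 'a \<Rightarrow> nat. (\<forall>u\<in>W - {v}. c u < m) \<and>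
        (\<forall>u\<in>W - {v}. \<forall>w\<in>W - {v}. (u, w) \<in> G \<longrightarrow> c u \<noteq> c w)"
      using v(1) by (intro psubset.IH psubset.prems) auto
    then obtain c :: "'a \<Rightarrow> nat" where c: "\<And>u. u \<in> W - {v} \<Longrightarrow> c u < m"
      "\<And>u w. u \<in> W - {v} \<Longrightarrow> w \<in> W - {v} \<Longrightarrow> (u, w) \<in> G \<Longrightarrow> c u \<noteq> c w" by blast
    let ?N = "{u \<in> W. (v, u) \<in> G}"
    have "card (c ` ?N) < card {..<m}"
      using v(2) card_image_le[of ?N c] psubset.hyps by auto
    then have "\<not> {..<m} \<subseteq> c ` ?N"
      using psubset.hyps card_mono[of "c ` ?N" "{..<m}"] by auto
    then obtain t where t: "t < m" "t \<notin> c ` ?N" by blast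
    have free: "c u \<noteq> t" if "u \<in> W" "(u, v) \<in> G \<or> (v, u) \<in> G" for u
      using t(2) that assms(2) by (blast dest: symD)
    have loopless: "(v, v) \<notin> G"
      using assms(3) by (simp add: irrefl_def)
    show ?thesis
    proof (intro exI[of _ "c(v := t)"] conjI ballI impI)
      fix u assume "u \<in> W"
      then show "(c(v := t)) u < m" using c(1) t(1) by simp
    next
      fix u w assume "u \<in> W" "w \<in> W" "(u, w) \<in> G"
      then show "(c(v := t)) u \<noteq> (c(v := t)) w"
        using c(2)[of u w] free[of u] free[of w] loopless by (cases "u = v"; cases "w = v") auto
    qed
  qed simp
qed

text \<open>
  If one plus the degree in \<open>W\<close> exceeded the norm of \<open>R\<close> at every vertex of \<open>W\<close>, then the Rayleigh quotient of \<open>R\<close> at the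
  indicator vector of \<open>W\<close>, which is one plus the average degree, would exceed it too.
\<close>

lemma exists_low_degree_vertex:
  fixes G :: "('n::finite \<times> 'n) set"
  assumes "irrefl G" "W \<noteq> {}"
  shows "\<exists>v\<in>W. real (card {u \<in> W. (v, u) \<in> G}) + 1 \<le> opnorm (R_mat G)"
proof (rule ccontr)
  assume "\<not> ?thesis"
  then have high: "opnorm (R_mat G) < real (card {u \<in> W. (v, u) \<in> G}) + 1" if "v \<in> W" for v
    using that by force
  define x :: "complex^'n" where "x = (\<chi> i. if i \<in> W then 1 else 0)"
  have x_nth: "x $ i = (if i \<in> W then 1 else 0)" for i
    by (simp add: x_def)
  have xx: "inner x x = card W"
    by (simp add: inner_vec_def x_def if_distrib[of "inner _"] if_distrib[of "\<lambda>z. inner z _"]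
        sum.If_cases cong: if_cong)
  have row: "(R_mat G *v x) $ v = of_nat (card {u \<in> W. (v, u) \<in> G} + 1)" if "v \<in> W" for v
  proof -
    have "(R_mat G *v x) $ v = (\<Sum>u\<in>UNIV. if u \<in> insert v {u \<in> W. (v, u) \<in> G} then 1 else 0)"
      unfolding matrix_vector_mult_def using that
      by (auto simp: R_mat_nth refl_graph_def x_def intro!: sum.cong)
    also have "\<dots> = of_nat (card (insert v {u \<in> W. (v, u) \<in> G}))"
      by (simp add: sum.If_cases del: insert_iff)
    also have "card (insert v {u \<in> W. (v, u) \<in> G}) = card {u \<in> W. (v, u) \<in> G} + 1"
      using assms(1) by (subst card_insert_disjoint) (auto simp: irrefl_def)
    finally show ?thesis .
  qed
  have "inner x (R_mat G *v x) = (\<Sum>v\<in>UNIV. if v \<in> W then real (card {u \<in> W. (v, u) \<in> G}) + 1 else 0)"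
    unfolding inner_vec_def by (intro sum.cong) (auto simp: x_nth row inner_complex_def)
  then have "inner x (R_mat G *v x) = (\<Sum>v\<in>W. real (card {u \<in> W. (v, u) \<in> G}) + 1)"
    by (simp add: sum.If_cases)
  also have "\<dots> > (\<Sum>v\<in>W. opnorm (R_mat G))"
    using high assms(2) by (intro sum_strict_mono) auto
  finally have "card W * opnorm (R_mat G) < inner x (R_mat G *v x)" by simp
  also have "\<dots> \<le> norm x * norm (R_mat G *v x)"
    by (rule norm_cauchy_schwarz)
  also have "\<dots> \<le> norm x * (opnorm (R_mat G) * norm x)"
    by (intro mult_left_mono norm_matrix_vector_le_opnorm) simp
  also have "\<dots> = card W * opnorm (R_mat G)"
    using xx by (simp add: dot_square_norm power2_eq_square)
  finally show False by simp
qed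

theorem wilf:
  fixes G :: "('n::finite \<times> 'n) set"
  assumes "sym G" "irrefl G"
  shows "chromatic_number G \<le> opnorm (R_mat G)"
proof -
  define m where "m = nat \<lfloor>opnorm (R_mat G)\<rfloor>"
  have "\<exists>v\<in>S. card {u \<in> S. (v, u) \<in> G} < m" if "S \<noteq> {}" for S :: "'n set"
  proof -
    obtain v where "v \<in> S" "real (card {u \<in> S. (v, u) \<in> G}) + 1 \<le> opnorm (R_mat G)"
      using exists_low_degree_vertex[OF assms(2) \<open>S \<noteq> {}\<close>] by blast
    then show ?thesis by (intro bexI[of _ v]) (simp_all add: m_def, linarith)
  qed
  then have "\<exists>c :: 'n \<Rightarrow> nat. (\<forall>v\<in>UNIV. c v < m) \<and> (\<forall>u\<in>UNIV. \<forall>v\<in>UNIV. (u, v) \<in> G \<longrightarrow> c u \<noteq> c v)"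
    by (intro greedy_colouring assms) auto
  then have "\<exists>c :: 'n \<Rightarrow> nat. (\<forall>v. c v < m) \<and> (\<forall>(u, v) \<in> G. c u \<noteq> c v)"
    by (simp add: case_prod_unfold split_paired_all) blast
  then have "chromatic_number G \<le> m"
    unfolding chromatic_number_def by (rule Least_le)
  then show ?thesis
    using opnorm_nonneg[of "R_mat G"] unfolding m_def by linarith
qed


section \<open>The projection and the distance\<close>

text \<open>
  Without a bound, the supremum in \<open>P_norm\<close> would be an unspecified number. Entrywise
  estimates give it: the entries of \<open>X\<close>, hence those of its projection, have modulus at most \<open>1\<close>.
\<close>

lemma bdd_above_P_norm:
  fixes G :: "('n::finite \<times> 'n) set"
  shows "bdd_above {opnorm (P_proj G X) | X. opnorm X \<le> 1}"
proof (rule bdd_aboveI)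
  fix r assume "r \<in> {opnorm (P_proj G X) | X. opnorm X \<le> 1}"
  then obtain X where X: "opnorm X \<le> 1" and r: "r = opnorm (P_proj G X)" by blast
  have "norm (P_proj G X $ i $ j) \<le> 1" for i j
    using norm_entry_le_opnorm[of X i j] X by (simp add: P_proj_def R_mat_nth)
  then have "(\<Sum>i\<in>UNIV. \<Sum>j\<in>UNIV. norm (P_proj G X $ i $ j)) \<le> (\<Sum>i\<in>(UNIV::'n set). \<Sum>j\<in>(UNIV::'n set). 1)"
    by (intro sum_mono)
  then show "r \<le> (\<Sum>i\<in>(UNIV::'n set). \<Sum>j\<in>(UNIV::'n set). 1)"
    using opnorm_le_sum_entries[of "P_proj G X"] unfolding r by linarith
qed

lemma opnorm_P_proj_le:
  fixes G :: "('n::finite \<times> 'n) set"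
  shows "opnorm (P_proj G X) \<le> P_norm G * opnorm X"
proof (cases "opnorm X = 0")
  case True
  then have "X = 0"
    using norm_entry_le_opnorm[of X] by (simp add: vec_eq_iff)
  then have "P_proj G X = X" by (simp add: P_proj_def vec_eq_iff)
  then show ?thesis using True by simp
next
  case False
  define a where "a = complex_of_real (inverse (opnorm X))"
  have pos: "opnorm X > 0" using False opnorm_nonneg[of X] by simp
  then have "opnorm (cmat_scale a X) \<le> 1"
    by (simp add: opnorm_cmat_scale a_def norm_inverse)
  then have "opnorm (P_proj G (cmat_scale a X)) \<le> P_norm G"
    unfolding P_norm_def by (intro cSup_upper bdd_above_P_norm) blast
  also have "P_proj G (cmat_scale a X) = cmat_scale a (P_proj G X)"
    by (simp add: P_proj_def cmat_scale_def vec_eq_iff)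
  finally show ?thesis
    using pos by (simp add: opnorm_cmat_scale a_def norm_divide field_simps)
qed

text \<open>The identity matrix is a fixed point of the projection.\<close>

lemma one_le_P_norm: "1 \<le> P_norm (G :: ('n::finite \<times> 'n) set)"
proof -
  have "P_proj G (mat 1) = mat 1"
    by (simp add: P_proj_def R_mat_nth refl_graph_def vec_eq_iff mat_def)
  then show ?thesis
    using opnorm_P_proj_le[of G "mat 1"] by (simp add: opnorm_mat_1)
qed

lemma opnorm_R_mat_le_d_inf:
  fixes G :: "('n::finite \<times> 'n) set"
  shows "opnorm (R_mat G) / P_norm G \<le> d_inf G (R_mat G)"
  unfolding d_inf_def
proof (rule cInf_greatest)
  have "0 \<in> S_perp G" unfolding S_perp_def by (rule cmat.span_zero)
  then show "{opnorm (R_mat G + K) |K. K \<in> S_perp G} \<noteq> {}" by blast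
next
  fix r assume "r \<in> {opnorm (R_mat G + K) |K. K \<in> S_perp G}"
  then obtain K where K: "K \<in> S_perp G" and r: "r = opnorm (R_mat G + K)" by blast
  have "P_proj G (R_mat G + K) = R_mat G"
    using K by (auto simp: S_perp_def span_matrix_units graph_compl_def P_proj_def R_mat_nth vec_eq_iff)
  then show "opnorm (R_mat G) / P_norm G \<le> r"
    using opnorm_P_proj_le[of G "R_mat G + K"] one_le_P_norm[of G]
    by (simp add: r divide_le_eq mult.commute)
qed


section \<open>The chromatic number and theta\<close>

theorem corollary6p2:
  fixes G :: "('n::finite \<times> 'n) set"
  assumes "sym G" and "irrefl G"
    and "lovasz_theta (graph_compl G) = d_inf G (R_mat G)"
  shows "real (chromatic_number G) / P_norm G \<le> lovasz_theta (graph_compl G) \<and>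
         lovasz_theta (graph_compl G) \<le> real (chromatic_number G)"
proof
  have "real (chromatic_number G) / P_norm G \<le> opnorm (R_mat G) / P_norm G"
    using wilf[OF assms(1,2)] one_le_P_norm[of G] by (intro divide_right_mono) auto
  also have "\<dots> \<le> lovasz_theta (graph_compl G)"
    unfolding assms(3) by (rule opnorm_R_mat_le_d_inf)
  finally show "real (chromatic_number G) / P_norm G \<le> lovasz_theta (graph_compl G)" .
  show "lovasz_theta (graph_compl G) \<le> real (chromatic_number G)"
    by (rule lovasz_theta_compl_le_chromatic_number[OF assms(2)])
qed

end
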